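(* Let $\mu\ge\mu_{\min}$, where $\mu_{\min}=2+\omega+\omega^{-1}\approx4.38$ with $\omega=\frac13\left(\sqrt[3]{19+3\sqrt{33}}+\sqrt[3]{19-3\sqrt{33}}+1\right)$. Let $G_k=G_k(\mathbb T,C)$, $k\ge1$, be a generalized Shearer sequence, with $\mathbb T=(T_1,T_2,\dots)$, which is dominated by $\mu$, i.e. $\lim_{k\to\infty}\rho_L(G_k)\le\mu$. Define $S_1=1-\mu+\delta(T_1,\mu)$ and $S_j=2-\mu-\frac1{S_{j-1}}+\delta(T_j,\mu)$ for $j\ge2$. If the sequence (indexed by $j\ge1$) $$\sum_{m=1}^{j}\frac{1+\delta'(T_m)}{\left(\prod_{n=m}^{j-1}S_n\right)^2}$$ is unbounded, where $\delta'(T_m)=\frac{d}{d\varepsilon}\delta(T_m,\mu-\varepsilon)\big|_{\varepsilon=0}$ and empty products equal $1$, then $\lim_{k\to\infty}\rho_L(G_k)=\mu$.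
   Context: For a finite graph $G$, $\rho_L(G)$ is the largest eigenvalue of the Laplacian matrix $L(G)=D(G)-A(G)$. A starlike tree is encoded as $T=[q_1,\dots,q_r]$ with positive integers $q_1\le\dots\le q_r$, or $T=[0]$ (empty); its width is $r$ (and $0$ for $[0]$). The linear tree $[T_1,\dots,T_k]$ is obtained from a path $v_1v_2\cdots v_k$ by attaching at each $v_j$, for $T_j=[q_1,\dots,q_r]$, $r$ disjoint pendant paths with $q_1,\dots,q_r$ vertices respectively (an end vertex of each is joined to $v_j$ by an edge); if $T_j=[0]$ nothing is attached. Generalized Shearer sequence: given sequences of starlike trees $\mathbb T=(T_1,T_2,\dots)$ and $C=(C_2,C_3,\dots)$, each with widths bounded by a constant, put $G_1=[T_1]$ and $G_k(\mathbb T,C)=[T_1,\dots,T_{k-1},C_k]$ for $k\ge2$; this is a generalized Shearer sequence if $\rho_L(G_k)<\rho_L(G_{k+1})$ for all $k\ge1$ (the limit of $\rho_L(G_k)$ then exists). Drift: for a real number $\nu$ put $b_1=1-\nu$, $b_{i+1}=2-\nu-\frac1{b_i}$, and $\delta([q_1,\dots,q_r],\nu)=\sum_{i=1}^r\left(1-\frac1{b_{q_i}}\right)$, $\delta([0],\nu)=0$. *)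

theory Defs
  imports "HOL-Analysis.Derivative" "Jordan_Normal_Form.Char_Poly"
begin

text \<open>A finite simple graph is a pair of a finite vertex set and a set of two-element subsets of it.\<close>

type_synonym 'a graph = "'a set \<times> 'a set set"

definition degree_matrix :: "'a set set \<Rightarrow> 'a list \<Rightarrow> real mat" where
  "degree_matrix E vs = mat (length vs) (length vs)
     (\<lambda>(i, j). if i = j then real (card {e \<in> E. vs ! i \<in> e}) else 0)"

definition adjacency_matrix :: "'a set set \<Rightarrow> 'a list \<Rightarrow> real mat" where
  "adjacency_matrix E vs = mat (length vs) (length vs)
     (\<lambda>(i, j). if {vs ! i, vs ! j} \<in> E then 1 else 0)"

definition laplacian_matrix :: "'a set set \<Rightarrow> 'a list \<Rightarrow> real mat" where
  "laplacian_matrix E vs = degree_matrix E vs - adjacency_matrix E vs"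

text \<open>Reordering the vertices conjugates the Laplacian matrix by a permutation matrix, so the choice
  of the enumeration is irrelevant for the eigenvalues.\<close>

definition vertex_enum :: "'a set \<Rightarrow> 'a list" where
  "vertex_enum V = (SOME vs. distinct vs \<and> set vs = V)"

definition rho_L :: "'a graph \<Rightarrow> real" where
  "rho_L G = Max {x. eigenvalue (laplacian_matrix (snd G) (vertex_enum (fst G))) x}"

text \<open>The empty starlike tree is encoded by \<open>[0]\<close>, not by the empty list.\<close>

definition starlike :: "nat list \<Rightarrow> bool" where
  "starlike T \<longleftrightarrow> T = [0] \<or> (T \<noteq> [] \<and> sorted T \<and> (\<forall>q\<in>set T. 0 < q))"

definition width :: "nat list \<Rightarrow> nat" where
  "width T = (if T = [0] then 0 else length T)"

text \<open>\<open>Spine j\<close> is the path vertex carrying the \<open>j\<close>-th starlike tree, and \<open>Pend j i p\<close> is the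
  \<open>p\<close>-th vertex, counted from the spine, of the \<open>i\<close>-th pendant path at \<open>Spine j\<close>. All three indices
  start at 0.\<close>

datatype vertex = Spine nat | Pend nat nat nat

text \<open>A pendant path of length 0 contributes neither a vertex nor an edge, so nothing is attached for
  \<open>[0]\<close>.\<close>

definition linear_tree :: "nat list list \<Rightarrow> vertex graph" where
  "linear_tree Ts =
    ({Spine j |j. j < length Ts}
       \<union> {Pend j i p |j i p. j < length Ts \<and> i < length (Ts ! j) \<and> p < Ts ! j ! i},
     {{Spine j, Spine (Suc j)} |j. Suc j < length Ts}
       \<union> {{Spine j, Pend j i 0} |j i. j < length Ts \<and> i < length (Ts ! j) \<and> 0 < Ts ! j ! i}
       \<union> {{Pend j i p, Pend j i (Suc p)} |j i p.
            j < length Ts \<and> i < length (Ts ! j) \<and> Suc p < Ts ! j ! i})"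

text \<open>The sequences \<open>T\<close>, \<open>C\<close> and \<open>shearer_graph T C\<close> are indexed from 1, 2 and 1 respectively; their
  values at smaller indices are irrelevant.\<close>

definition shearer_graph :: "(nat \<Rightarrow> nat list) \<Rightarrow> (nat \<Rightarrow> nat list) \<Rightarrow> nat \<Rightarrow> vertex graph" where
  "shearer_graph T C k =
     (if k = 1 then linear_tree [T 1] else linear_tree (map T [1..<k] @ [C k]))"

definition generalized_shearer_sequence :: "(nat \<Rightarrow> nat list) \<Rightarrow> (nat \<Rightarrow> nat list) \<Rightarrow> bool" where
  "generalized_shearer_sequence T C \<longleftrightarrow>
     (\<forall>j\<ge>1. starlike (T j)) \<and> (\<exists>w. \<forall>j\<ge>1. width (T j) \<le> w) \<and>
     (\<forall>j\<ge>2. starlike (C j)) \<and> (\<exists>w. \<forall>j\<ge>2. width (C j) \<le> w) \<and>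
     (\<forall>k\<ge>1. rho_L (shearer_graph T C k) < rho_L (shearer_graph T C (Suc k)))"

text \<open>For a generalized Shearer sequence the limit exists: the sequence is increasing, and it is
  bounded because the vertex degrees are.\<close>

definition dominated_by :: "(nat \<Rightarrow> nat list) \<Rightarrow> (nat \<Rightarrow> nat list) \<Rightarrow> real \<Rightarrow> bool" where
  "dominated_by T C \<mu> \<longleftrightarrow> lim (\<lambda>k. rho_L (shearer_graph T C k)) \<le> \<mu>"

text \<open>Only the values at positive indices are meaningful.\<close>

fun b_seq :: "real \<Rightarrow> nat \<Rightarrow> real" where
  "b_seq \<nu> 0 = 0"
| "b_seq \<nu> (Suc 0) = 1 - \<nu>"
| "b_seq \<nu> (Suc (Suc i)) = 2 - \<nu> - 1 / b_seq \<nu> (Suc i)"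

definition drift :: "nat list \<Rightarrow> real \<Rightarrow> real" where
  "drift T \<nu> = (if T = [0] then 0 else (\<Sum>q\<leftarrow>T. 1 - 1 / b_seq \<nu> q))"

definition drift_deriv :: "nat list \<Rightarrow> real \<Rightarrow> real" where
  "drift_deriv T \<mu> = deriv (\<lambda>\<epsilon>. drift T (\<mu> - \<epsilon>)) 0"

text \<open>Only the values at positive indices are meaningful.\<close>

fun S_seq :: "(nat \<Rightarrow> nat list) \<Rightarrow> real \<Rightarrow> nat \<Rightarrow> real" where
  "S_seq T \<mu> 0 = 0"
| "S_seq T \<mu> (Suc 0) = 1 - \<mu> + drift (T 1) \<mu>"
| "S_seq T \<mu> (Suc (Suc j)) = 2 - \<mu> - 1 / S_seq T \<mu> (Suc j) + drift (T (Suc (Suc j))) \<mu>"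

definition omega :: real where
  "omega = 1 / 3 * (root 3 (19 + 3 * sqrt 33) + root 3 (19 - 3 * sqrt 33) + 1)"

definition mu_min :: real where
  "mu_min = 2 + omega + inverse omega"

end

theory Submission
  imports Defs "HOL-Analysis.Function_Topology" "Jordan_Normal_Form.Spectral_Radius"
begin

text \<open>Suppose that the limit \<open>L\<close> of the spectral radii is less than \<open>\<mu>\<close>. On the first \<open>j\<close> spine
  vertices of \<open>G\<^bsub>j+1\<^esub>\<close> and their pendant paths there is a vector \<open>x\<close>, equal to 1 at the \<open>j\<close>-th spine
  vertex and 0 on the rest of the tree, that solves the eigenvalue equation for \<open>\<mu>\<close> everywhere on its
  support except at the \<open>j\<close>-th spine vertex, where the defect is the pivot \<open>S\<^sub>j\<close>. Its squared norm is
  the \<open>j\<close>-th term \<open>a\<^sub>j\<close> of the sequence in the statement, so the Rayleigh principle gives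
  \<open>S\<^sub>j \<le> - (\<mu> - L) a\<^sub>j < 0\<close>. As all pivots are negative, the recursion gives \<open>S\<^sub>j \<ge> 1 - \<mu>\<close>, and
  therefore \<open>a\<^sub>j \<le> (\<mu> - 1) / (\<mu> - L)\<close> is bounded.\<close>

unbundle no vec_syntax

section \<open>The Rayleigh principle\<close>

text \<open>A zero of a positive semidefinite form is a minimum, so the first variation vanishes
  there. Along the \<open>k\<close>-th coordinate direction the form becomes
  \<open>2 * t * c + t\<^sup>2 * d\<close>, which is negative for some \<open>t\<close> unless
  \<open>c = 0\<close>.\<close>

lemma psd_form_zero_imp_kernel:
  fixes B :: "'a \<Rightarrow> 'a \<Rightarrow> real"
  assumes fin: "finite I" and sym: "\<And>i j. i \<in> I \<Longrightarrow> j \<in> I \<Longrightarrow> B i j = B j i"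
    and psd: "\<And>y. 0 \<le> (\<Sum>i\<in>I. \<Sum>j\<in>I. y i * B i j * y j)"
    and zero: "(\<Sum>i\<in>I. \<Sum>j\<in>I. x i * B i j * x j) = 0"
    and k: "k \<in> I"
  shows "(\<Sum>j\<in>I. B k j * x j) = 0"
proof (rule ccontr)
  define c where "c = (\<Sum>j\<in>I. B k j * x j)"
  define d where "d = B k k"
  assume "\<not> ?thesis"
  then have c0: "c \<noteq> 0" by (simp add: c_def)
  have expand: "(\<Sum>i\<in>I. \<Sum>j\<in>I. (x i + t * of_bool (i = k)) * B i j * (x j + t * of_bool (j = k)))
      = 2 * t * c + t\<^sup>2 * d" for t
  proof -
    have "(\<Sum>i\<in>I. \<Sum>j\<in>I. (x i + t * of_bool (i = k)) * B i j * (x j + t * of_bool (j = k)))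
      = (\<Sum>i\<in>I. \<Sum>j\<in>I. x i * B i j * x j)
        + (\<Sum>i\<in>I. \<Sum>j\<in>I. if j = k then t * x i * B i k else 0)
        + (\<Sum>i\<in>I. \<Sum>j\<in>I. if i = k then t * B k j * x j else 0)
        + (\<Sum>i\<in>I. \<Sum>j\<in>I. if i = k then if j = k then t\<^sup>2 * B k k else 0 else 0)"
      unfolding sum.distrib[symmetric]
      by (intro sum.cong refl) (auto simp: algebra_simps power2_eq_square)
    also have "(\<Sum>i\<in>I. \<Sum>j\<in>I. if j = k then t * x i * B i k else 0) = t * c"
      using fin k by (auto simp: c_def sum_distrib_left sym algebra_simps intro!: sum.cong)
    also have "(\<Sum>i\<in>I. \<Sum>j\<in>I. if i = k then t * B k j * x j else 0) = t * c"
      using fin k by (subst sum.swap) (simp add: c_def sum_distrib_left algebra_simps)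
    also have "(\<Sum>i\<in>I. \<Sum>j\<in>I. if i = k then if j = k then t\<^sup>2 * B k k else 0 else 0) = t\<^sup>2 * d"
      using fin k by (subst sum.swap) (simp add: d_def)
    finally show ?thesis by (simp add: zero)
  qed
  have nn: "0 \<le> 2 * t * c + t\<^sup>2 * d" for t
    using psd[of "\<lambda>i. x i + t * of_bool (i = k)"] unfolding expand .
  \<comment> \<open>\<open>d\<close> may be zero, so a positive bound \<open>e\<close> replaces it;
    \<open>t = - c / e\<close> minimises \<open>2 * t * c + t\<^sup>2 * e\<close>.\<close>
  define e where "e = \<bar>d\<bar> + 1"
  have e: "e > 0" "d \<le> e" by (auto simp: e_def)
  define t where "t = - c / e"
  have "2 * t * c + t\<^sup>2 * d \<le> 2 * t * c + t\<^sup>2 * e"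
    using e by (intro add_left_mono mult_left_mono) auto
  also have "\<dots> = - c\<^sup>2 / e"
    using e by (simp add: t_def field_simps power2_eq_square)
  also have "\<dots> < 0" using c0 e by (simp add: field_simps)
  finally show False using nn[of t] by simp
qed

text \<open>Vectors indexed by \<open>I\<close> are modelled as functions vanishing off
  \<open>I\<close>. The sphere is then a closed part of a product of compact intervals and points,
  which is compact by Tychonoff's theorem.\<close>

lemma compact_unit_sphere_coordinates:
  assumes "finite I"
  shows "compact {x :: 'a \<Rightarrow> real. (\<forall>i. i \<notin> I \<longrightarrow> x i = 0) \<and> (\<Sum>i\<in>I. (x i)\<^sup>2) = 1}"
proof -
  let ?K = "PiE UNIV (\<lambda>i. if i \<in> I then {-1..1::real} else {0})"
  have "compactin (product_topology (\<lambda>i::'a. euclidean) UNIV) ?K"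
    by (subst compactin_PiE) (auto simp: compactin_euclidean_iff)
  then have K: "compact ?K"
    by (simp add: euclidean_product_topology compactin_euclidean_iff)
  have "closed {x :: 'a \<Rightarrow> real. (\<Sum>i\<in>I. (x i)\<^sup>2) = 1}"
    by (intro closed_Collect_eq continuous_intros) auto
  then have "compact (?K \<inter> {x. (\<Sum>i\<in>I. (x i)\<^sup>2) = 1})"
    by (rule compact_Int_closed[OF K])
  moreover have "\<bar>x i\<bar> \<le> 1" if "(\<Sum>i\<in>I. (x i)\<^sup>2) = 1" "i \<in> I" for x :: "'a \<Rightarrow> real" and i
    using member_le_sum[of i I "\<lambda>i. (x i)\<^sup>2"] that assms by (simp add: abs_square_le_1)
  then have "?K \<inter> {x. (\<Sum>i\<in>I. (x i)\<^sup>2) = 1}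
      = {x. (\<forall>i. i \<notin> I \<longrightarrow> x i = 0) \<and> (\<Sum>i\<in>I. (x i)\<^sup>2) = 1}"
    by (auto simp: PiE_iff abs_le_iff split: if_splits)
  ultimately show ?thesis by simp
qed

text \<open>Take for \<open>m\<close> the maximum of the form on the unit sphere. Then
  \<open>m\<close> times the identity minus \<open>B\<close> is positive semidefinite and vanishes
  at a maximiser, which therefore lies in its kernel.\<close>

lemma rayleigh_principle:
  fixes B :: "'a \<Rightarrow> 'a \<Rightarrow> real"
  assumes fin: "finite I" and ne: "I \<noteq> {}"
    and sym: "\<And>i j. i \<in> I \<Longrightarrow> j \<in> I \<Longrightarrow> B i j = B j i"
  obtains x m where "\<exists>i\<in>I. x i \<noteq> 0"
    and "\<And>i. i \<in> I \<Longrightarrow> (\<Sum>j\<in>I. B i j * x j) = m * x i"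
    and "\<And>y. (\<Sum>i\<in>I. \<Sum>j\<in>I. y i * B i j * y j) \<le> m * (\<Sum>i\<in>I. (y i)\<^sup>2)"
proof -
  define Q where "Q = (\<lambda>x. \<Sum>i\<in>I. \<Sum>j\<in>I. x i * B i j * x j)"
  define N where "N = (\<lambda>x. \<Sum>i\<in>I. (x i :: real)\<^sup>2)"
  let ?S = "{x :: 'a \<Rightarrow> real. (\<forall>i. i \<notin> I \<longrightarrow> x i = 0) \<and> N x = 1}"
  obtain a where a: "a \<in> I" using ne by blast
  have "(\<lambda>i. if i = a then 1 else 0) \<in> ?S"
    using a fin by (auto simp: N_def if_distrib[where f = "\<lambda>x. x\<^sup>2"] cong: if_cong)
  moreover have "continuous_on ?S Q"
    unfolding Q_def by (intro continuous_intros) (auto intro: continuous_on_product_then_coordinatewise continuous_on_id)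
  moreover have "compact ?S"
    unfolding N_def by (rule compact_unit_sphere_coordinates[OF fin])
  ultimately have "\<exists>x\<in>?S. \<forall>y\<in>?S. Q y \<le> Q x"
    by (intro continuous_attains_sup) auto
  then obtain x where x: "x \<in> ?S" and max': "\<forall>y\<in>?S. Q y \<le> Q x"
    by (rule bexE)
  note max = bspec[OF max']
  define m where "m = Q x"
  have bound: "Q y \<le> m * N y" for y
  proof (cases "N y = 0")
    case True
    then have "y i = 0" if "i \<in> I" for i
      using that fin by (simp add: N_def sum_nonneg_eq_0_iff)
    then have "Q y = 0" by (simp add: Q_def)
    then show ?thesis by (simp add: True)
  next
    case False
    moreover have "0 \<le> N y" by (simp add: N_def sum_nonneg)
    ultimately have pos: "N y > 0" by simp
    define s where "s = sqrt (N y)"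
    have s: "s > 0" "s\<^sup>2 = N y"
      using pos unfolding s_def by (auto intro: real_sqrt_pow2)
    \<comment> \<open>\<open>y\<close> is arbitrary off \<open>I\<close>, while members of
      \<open>?S\<close> vanish there; \<open>Q\<close> and \<open>N\<close> read only the values on
      \<open>I\<close>.\<close>
    define z where "z i = (if i \<in> I then y i / s else 0)" for i
    have "N z = N y / s\<^sup>2"
      by (simp add: N_def z_def power_divide sum_divide_distrib)
    then have "z \<in> ?S" using s pos by (simp add: z_def)
    then have "Q z \<le> m" using max by (simp add: m_def)
    moreover have "Q z = Q y / s\<^sup>2"
      by (simp add: Q_def z_def power2_eq_square sum_divide_distrib)
    ultimately show ?thesis using s pos by (simp add: field_simps)
  qed
  let ?B = "\<lambda>i j. m * of_bool (i = j) - B i j"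
  have form: "(\<Sum>i\<in>I. \<Sum>j\<in>I. y i * ?B i j * y j) = m * N y - Q y" for y
  proof -
    have "(\<Sum>i\<in>I. \<Sum>j\<in>I. y i * ?B i j * y j)
        = (\<Sum>i\<in>I. \<Sum>j\<in>I. (if j = i then m * (y i)\<^sup>2 else 0) - y i * B i j * y j)"
      by (intro sum.cong refl) (auto simp: algebra_simps power2_eq_square)
    then show ?thesis using fin by (simp add: sum_subtractf N_def Q_def sum_distrib_left)
  qed
  have "(\<Sum>j\<in>I. ?B i j * x j) = 0" if "i \<in> I" for i
  proof (rule psd_form_zero_imp_kernel[OF fin _ _ _ that])
    show "0 \<le> (\<Sum>i\<in>I. \<Sum>j\<in>I. y i * ?B i j * y j)" for y
      using bound[of y] by (simp add: form)
    show "(\<Sum>i\<in>I. \<Sum>j\<in>I. x i * ?B i j * x j) = 0"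
      using x unfolding form by (simp add: m_def)
  qed (use sym in auto)
  moreover have "(\<Sum>j\<in>I. ?B i j * x j) = m * x i - (\<Sum>j\<in>I. B i j * x j)" if "i \<in> I" for i
  proof -
    have "(\<Sum>j\<in>I. ?B i j * x j) = (\<Sum>j\<in>I. (if j = i then m * x i else 0) - B i j * x j)"
      by (intro sum.cong refl) (auto simp: algebra_simps)
    then show ?thesis using fin that by (simp add: sum_subtractf)
  qed
  ultimately have eig: "(\<Sum>j\<in>I. B i j * x j) = m * x i" if "i \<in> I" for i
    using that by simp
  have "\<exists>i\<in>I. x i \<noteq> 0"
  proof (rule ccontr)
    assume "\<not> ?thesis"
    then have "N x = 0" by (simp add: N_def)
    then show False using x by simp
  qed
  then show ?thesis using that[of x m] eig bound by (simp add: Q_def N_def)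
qed

section \<open>Largest eigenvalue of a symmetric real matrix\<close>

lemma scalar_prod_mult_mat_vec:
  assumes "A \<in> carrier_mat n n" "y \<in> carrier_vec n"
  shows "y \<bullet> (A *\<^sub>v y) = (\<Sum>i<n. \<Sum>j<n. y $ i * A $$ (i, j) * y $ j)"
proof -
  have "y $ i * (A *\<^sub>v y) $ i = (\<Sum>j<n. y $ i * A $$ (i, j) * y $ j)" if "i < n" for i
    using assms that by (simp add: scalar_prod_def atLeast0LessThan sum_distrib_left mult.assoc)
  then show ?thesis
    using assms by (simp add: scalar_prod_def[of _ "A *\<^sub>v y"] atLeast0LessThan)
qed

text \<open>The Rayleigh maximum \<open>m\<close> is an eigenvalue, so the finite spectrum is
  nonempty and its \<open>Max\<close> is attained. Since \<open>m\<close> is at most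
  \<open>Max\<close>, the Rayleigh bound carries over.\<close>

lemma symmetric_mat_max_eigenvalue:
  fixes A :: "real mat"
  assumes A: "A \<in> carrier_mat n n" and n: "0 < n"
    and sym: "\<And>i j. i < n \<Longrightarrow> j < n \<Longrightarrow> A $$ (i, j) = A $$ (j, i)"
  shows "eigenvalue A (Max {x. eigenvalue A x})"
    and "y \<in> carrier_vec n \<Longrightarrow> y \<bullet> (A *\<^sub>v y) \<le> Max {x. eigenvalue A x} * (y \<bullet> y)"
proof -
  obtain x m where x0: "\<exists>i\<in>{..<n}. x i \<noteq> 0"
    and eig: "\<And>i. i \<in> {..<n} \<Longrightarrow> (\<Sum>j<n. A $$ (i, j) * x j) = m * x i"
    and bound: "\<And>y. (\<Sum>i<n. \<Sum>j<n. y i * A $$ (i, j) * y j) \<le> m * (\<Sum>i<n. (y i)\<^sup>2)"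
    by (rule rayleigh_principle[of "{..<n}" "\<lambda>i j. A $$ (i, j)"]) (use n sym in auto)
  have "eigenvector A (vec n x) m"
    unfolding eigenvector_def
  proof (intro conjI)
    show "vec n x \<noteq> 0\<^sub>v (dim_row A)"
    proof
      assume "vec n x = 0\<^sub>v (dim_row A)"
      then have "vec n x $ i = 0" if "i < n" for i using that A by simp
      then show False using x0 by auto
    qed
    show "A *\<^sub>v vec n x = m \<cdot>\<^sub>v vec n x"
      using A eig by (intro eq_vecI) (auto simp: scalar_prod_def atLeast0LessThan)
  qed (use A in auto)
  then have m: "m \<in> {x. eigenvalue A x}" by (auto simp: eigenvalue_def)
  have fin: "finite {x. eigenvalue A x}"
    using card_finite_spectrum(1)[OF A] by (simp add: spectrum_def)
  show "eigenvalue A (Max {x. eigenvalue A x})"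
    using Max_in[OF fin] m by auto
  show "y \<bullet> (A *\<^sub>v y) \<le> Max {x. eigenvalue A x} * (y \<bullet> y)" if y: "y \<in> carrier_vec n"
  proof -
    have yy: "y \<bullet> y = (\<Sum>i<n. (y $ i)\<^sup>2)"
      using y by (simp add: scalar_prod_def atLeast0LessThan power2_eq_square)
    have "y \<bullet> (A *\<^sub>v y) \<le> m * (y \<bullet> y)"
      using bound[of "($) y"] by (simp add: scalar_prod_mult_mat_vec[OF A y] yy)
    also have "\<dots> \<le> Max {x. eigenvalue A x} * (y \<bullet> y)"
      using Max_ge[OF fin m] by (intro mult_right_mono) (auto simp: yy sum_nonneg)
    finally show ?thesis .
  qed
qed

section \<open>Laplacian matrices\<close>

text \<open>On an edge with ends \<open>a\<close> and \<open>b\<close> this is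
  \<open>(f a - f b)\<^sup>2\<close>. The formula depends on the set \<open>e\<close> only, so no
  orientation has to be chosen.\<close>

definition edge_energy :: "('a \<Rightarrow> real) \<Rightarrow> 'a set \<Rightarrow> real" where
  "edge_energy f e = 2 * (\<Sum>u\<in>e. (f u)\<^sup>2) - (\<Sum>u\<in>e. f u)\<^sup>2"

lemma edge_energy_doubleton: "a \<noteq> b \<Longrightarrow> edge_energy f {a, b} = (f a - f b)\<^sup>2"
  by (simp add: edge_energy_def power2_eq_square algebra_simps)

lemma edge_energy_le: "edge_energy f e \<le> 2 * (\<Sum>u\<in>e. (f u)\<^sup>2)"
  by (simp add: edge_energy_def)

definition finite_graph :: "'a graph \<Rightarrow> bool" where
  "finite_graph G \<longleftrightarrow> finite (fst G) \<and> fst G \<noteq> {} \<and> finite (snd G) \<and>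
     (\<forall>e\<in>snd G. \<exists>a b. a \<in> fst G \<and> b \<in> fst G \<and> a \<noteq> b \<and> e = {a, b})"

text \<open>Double counting of the pairs of an edge and one of its ends.\<close>

lemma sum_degree_weighted:
  fixes g :: "'a \<Rightarrow> real"
  assumes "finite V" "finite E" "\<And>e. e \<in> E \<Longrightarrow> e \<subseteq> V"
  shows "(\<Sum>u\<in>V. real (card {e \<in> E. u \<in> e}) * g u) = (\<Sum>e\<in>E. \<Sum>u\<in>e. g u)"
proof -
  have "(\<Sum>u\<in>V. real (card {e \<in> E. u \<in> e}) * g u) = (\<Sum>u\<in>V. \<Sum>e\<in>E. if u \<in> e then g u else 0)"
    using assms(2) by (simp add: sum.If_cases Int_def)
  also have "\<dots> = (\<Sum>e\<in>E. \<Sum>u\<in>V. if u \<in> e then g u else 0)"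
    by (rule sum.swap)
  also have "\<dots> = (\<Sum>e\<in>E. \<Sum>u\<in>e. g u)"
    using assms(1,3) by (intro sum.cong[OF refl, of E]) (simp add: inf.absorb2 flip: sum.inter_restrict)
  finally show ?thesis .
qed

text \<open>Each edge \<open>{a, b}\<close> arises from two ordered pairs, contributing
  \<open>2 * (f a * f b)\<close>, which is the square of the sum minus the sum of the
  squares.\<close>

lemma sum_adjacency_weighted:
  fixes f :: "'a \<Rightarrow> real"
  assumes "finite V" "finite E" 
    and E: "\<And>e. e \<in> E \<Longrightarrow> \<exists>a b. a \<in> V \<and> b \<in> V \<and> a \<noteq> b \<and> e = {a, b}"
  shows "(\<Sum>u\<in>V. \<Sum>w\<in>V. if {u, w} \<in> E then f u * f w else 0)
    = (\<Sum>e\<in>E. (\<Sum>u\<in>e. f u)\<^sup>2 - (\<Sum>u\<in>e. (f u)\<^sup>2))"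
proof -
  have "(\<Sum>u\<in>V. \<Sum>w\<in>V. if {u, w} \<in> E then f u * f w else 0)
      = (\<Sum>u\<in>V. \<Sum>w\<in>V. \<Sum>e\<in>E. if e = {u, w} then f u * f w else 0)"
    using assms(2) by simp
  also have "\<dots> = (\<Sum>u\<in>V. \<Sum>e\<in>E. \<Sum>w\<in>V. if e = {u, w} then f u * f w else 0)"
    by (intro sum.cong refl sum.swap)
  also have "\<dots> = (\<Sum>e\<in>E. \<Sum>u\<in>V. \<Sum>w\<in>V. if e = {u, w} then f u * f w else 0)"
    by (rule sum.swap)
  also have "\<dots> = (\<Sum>e\<in>E. (\<Sum>u\<in>e. f u)\<^sup>2 - (\<Sum>u\<in>e. (f u)\<^sup>2))"
  proof (intro sum.cong refl)
    fix e assume "e \<in> E"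
    then obtain a b where ab: "a \<in> V" "b \<in> V" "a \<noteq> b" and e: "e = {a, b}" using E by blast
    have "(\<Sum>u\<in>V. \<Sum>w\<in>V. if e = {u, w} then f u * f w else 0)
      = (\<Sum>u\<in>V. \<Sum>w\<in>V. (if w = b then if u = a then f a * f b else 0 else 0)
          + (if w = a then if u = b then f a * f b else 0 else 0))"
      using ab by (intro sum.cong refl) (auto simp: e doubleton_eq_iff)
    also have "\<dots> = 2 * (f a * f b)"
      using ab assms(1) by (simp add: sum.distrib)
    also have "\<dots> = (\<Sum>u\<in>e. f u)\<^sup>2 - (\<Sum>u\<in>e. (f u)\<^sup>2)"
      using ab by (simp add: e power2_eq_square algebra_simps)
    finally show "(\<Sum>u\<in>V. \<Sum>w\<in>V. if e = {u, w} then f u * f w else 0)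
      = (\<Sum>u\<in>e. f u)\<^sup>2 - (\<Sum>u\<in>e. (f u)\<^sup>2)" .
  qed
  finally show ?thesis .
qed

lemma sum_nth_distinct:
  assumes "distinct vs"
  shows "(\<Sum>i<length vs. g (vs ! i)) = (\<Sum>u\<in>set vs. g u)"
  using assms by (intro sum.reindex_bij_betw bij_betw_nth) auto

lemma laplacian_carrier: "laplacian_matrix E vs \<in> carrier_mat (length vs) (length vs)"
  by (simp add: laplacian_matrix_def degree_matrix_def adjacency_matrix_def minus_carrier_mat)

lemma laplacian_quadratic_form:
  fixes f :: "'a \<Rightarrow> real"
  assumes dist: "distinct vs" and E: "finite E"
    and pair: "\<And>e. e \<in> E \<Longrightarrow> \<exists>a b. a \<in> set vs \<and> b \<in> set vs \<and> a \<noteq> b \<and> e = {a, b}"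
  defines "x \<equiv> vec (length vs) (\<lambda>i. f (vs ! i))"
  shows "x \<bullet> (laplacian_matrix E vs *\<^sub>v x) = (\<Sum>e\<in>E. edge_energy f e)"
proof -
  let ?n = "length vs" and ?V = "set vs"
  let ?d = "\<lambda>u. real (card {e \<in> E. u \<in> e})"
  have ent: "laplacian_matrix E vs $$ (i, j)
      = (if i = j then ?d (vs ! i) else 0) - (if {vs ! i, vs ! j} \<in> E then 1 else 0)"
    if "i < ?n" "j < ?n" for i j
    using that by (simp add: laplacian_matrix_def degree_matrix_def adjacency_matrix_def)
  have "x \<bullet> (laplacian_matrix E vs *\<^sub>v x)
      = (\<Sum>i<?n. \<Sum>j<?n. x $ i * laplacian_matrix E vs $$ (i, j) * x $ j)"
    by (rule scalar_prod_mult_mat_vec[OF laplacian_carrier]) (simp add: x_def)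
  also have "\<dots> = (\<Sum>i<?n. \<Sum>j<?n. (if j = i then ?d (vs ! i) * (f (vs ! i))\<^sup>2 else 0)
      - (if {vs ! i, vs ! j} \<in> E then f (vs ! i) * f (vs ! j) else 0))"
    by (intro sum.cong refl) (auto simp: ent x_def algebra_simps power2_eq_square)
  also have "\<dots> = (\<Sum>i<?n. ?d (vs ! i) * (f (vs ! i))\<^sup>2)
      - (\<Sum>i<?n. \<Sum>j<?n. if {vs ! i, vs ! j} \<in> E then f (vs ! i) * f (vs ! j) else 0)"
    by (simp add: sum_subtractf)
  also have "(\<Sum>i<?n. ?d (vs ! i) * (f (vs ! i))\<^sup>2) = (\<Sum>e\<in>E. \<Sum>u\<in>e. (f u)\<^sup>2)"
  proof -
    have "e \<subseteq> ?V" if "e \<in> E" for e using pair[OF that] by auto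
    then show ?thesis
      unfolding sum_nth_distinct[OF dist, of "\<lambda>u. ?d u * (f u)\<^sup>2"]
      using E by (intro sum_degree_weighted) auto
  qed
  also have "(\<Sum>i<?n. \<Sum>j<?n. if {vs ! i, vs ! j} \<in> E then f (vs ! i) * f (vs ! j) else 0)
      = (\<Sum>u\<in>?V. \<Sum>w\<in>?V. if {u, w} \<in> E then f u * f w else 0)"
    using sum_nth_distinct[OF dist, of "\<lambda>u. \<Sum>w\<in>?V. if {u, w} \<in> E then f u * f w else 0"]
      sum_nth_distinct[OF dist, of "\<lambda>w. if {u, w} \<in> E then f u * f w else 0" for u]
    by simp
  also have "\<dots> = (\<Sum>e\<in>E. (\<Sum>u\<in>e. f u)\<^sup>2 - (\<Sum>u\<in>e. (f u)\<^sup>2))"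
    using pair E by (intro sum_adjacency_weighted) auto
  also have "(\<Sum>e\<in>E. \<Sum>u\<in>e. (f u)\<^sup>2) - \<dots> = (\<Sum>e\<in>E. edge_energy f e)"
    unfolding edge_energy_def sum_subtractf[symmetric] by (intro sum.cong refl) simp
  finally show ?thesis .
qed

lemma vertex_enum:
  assumes "finite V"
  shows "distinct (vertex_enum V)" "set (vertex_enum V) = V"
proof -
  have "\<exists>vs. distinct vs \<and> set vs = V" using finite_distinct_list[OF assms] by metis
  then have "distinct (vertex_enum V) \<and> set (vertex_enum V) = V"
    unfolding vertex_enum_def by (rule someI_ex)
  then show "distinct (vertex_enum V)" "set (vertex_enum V) = V" by auto
qed

lemma laplacian_symmetric:
  "i < length vs \<Longrightarrow> j < length vs \<Longrightarrow> laplacian_matrix E vs $$ (i, j) = laplacian_matrix E vs $$ (j, i)"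
  by (auto simp: laplacian_matrix_def degree_matrix_def adjacency_matrix_def insert_commute)

lemma vec_scalar_prod_self:
  fixes f :: "'a \<Rightarrow> real"
  assumes "distinct vs"
  shows "vec (length vs) (\<lambda>i. f (vs ! i)) \<bullet> vec (length vs) (\<lambda>i. f (vs ! i)) = (\<Sum>u\<in>set vs. (f u)\<^sup>2)"
  using sum_nth_distinct[OF assms, of "\<lambda>u. (f u)\<^sup>2"]
  by (simp add: scalar_prod_def atLeast0LessThan power2_eq_square)

text \<open>This form of the Rayleigh principle is free of matrices and enumerations, so that test
  functions on a tree can be inserted directly.\<close>

lemma energy_le_rho_L:
  assumes G: "finite_graph G"
  shows "(\<Sum>e\<in>snd G. edge_energy f e) \<le> rho_L G * (\<Sum>u\<in>fst G. (f u)\<^sup>2)"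
proof -
  have fin: "finite (fst G)" and ne: "fst G \<noteq> {}" using G by (auto simp: finite_graph_def)
  note vs = vertex_enum[OF fin]
  let ?vs = "vertex_enum (fst G)"
  have "0 < length ?vs" using vs(2) ne by auto
  from symmetric_mat_max_eigenvalue(2)[OF laplacian_carrier this laplacian_symmetric,
      of "vec (length ?vs) (\<lambda>i. f (?vs ! i))" "snd G"]
  show ?thesis
    using G vs(2)
    by (simp add: laplacian_quadratic_form[OF vs(1)] vec_scalar_prod_self[OF vs(1)]
        finite_graph_def rho_L_def)
qed

text \<open>For an eigenvector of \<open>rho_L G\<close>, the energy is at most twice the sum, over
  all edges, of the squares at their ends, where each vertex occurs as often as its degree.\<close>

lemma rho_L_le_twice_max_degree:
  assumes G: "finite_graph G" and deg: "\<And>u. u \<in> fst G \<Longrightarrow> card {e \<in> snd G. u \<in> e} \<le> d"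
  shows "rho_L G \<le> 2 * real d"
proof -
  have fin: "finite (fst G)" and ne: "fst G \<noteq> {}" and E: "finite (snd G)"
    using G by (auto simp: finite_graph_def)
  note vs = vertex_enum[OF fin]
  let ?vs = "vertex_enum (fst G)" and ?V = "fst G" and ?E = "snd G"
  let ?L = "laplacian_matrix ?E ?vs"
  have "0 < length ?vs" using vs(2) ne by auto
  from symmetric_mat_max_eigenvalue(1)[OF laplacian_carrier this laplacian_symmetric]
  have "eigenvalue ?L (rho_L G)" by (simp add: rho_L_def)
  then obtain v where v: "v \<in> carrier_vec (length ?vs)" "v \<noteq> 0\<^sub>v (length ?vs)"
    and Lv: "?L *\<^sub>v v = rho_L G \<cdot>\<^sub>v v"
    using laplacian_carrier[of ?E ?vs] by (auto simp: eigenvalue_def eigenvector_def)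
  \<comment> \<open>The eigenvector is moved from positions in the enumeration to vertices.\<close>
  define f where "f u = v $ (the_inv_into {..<length ?vs} ((!) ?vs) u)" for u
  have inj: "inj_on ((!) ?vs) {..<length ?vs}"
    using vs(1) by (auto simp: inj_on_def nth_eq_iff_index_eq)
  have fv: "f (?vs ! i) = v $ i" if "i < length ?vs" for i
    using that inj by (simp add: f_def the_inv_into_f_f)
  have v_eq: "v = vec (length ?vs) (\<lambda>i. f (?vs ! i))"
    using v(1) by (intro eq_vecI) (auto simp: fv)
  have norm: "v \<bullet> v = (\<Sum>u\<in>?V. (f u)\<^sup>2)"
    by (subst (1 2) v_eq) (simp add: vec_scalar_prod_self[OF vs(1)] vs(2))
  obtain i where i: "i < length ?vs" "v $ i \<noteq> 0"
  proof (rule ccontr)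
    assume "\<not> thesis"
    then have "v = 0\<^sub>v (length ?vs)" using that v(1) by (intro eq_vecI) auto
    then show False using v(2) by simp
  qed
  have "?vs ! i \<in> ?V" using i(1) vs(2) nth_mem by blast
  then have pos: "0 < (\<Sum>u\<in>?V. (f u)\<^sup>2)"
    using fin i by (intro sum_pos2[of _ "?vs ! i"]) (auto simp: fv)
  have "rho_L G * (\<Sum>u\<in>?V. (f u)\<^sup>2) = v \<bullet> (?L *\<^sub>v v)"
    using v(1) by (simp add: Lv norm)
  also have "\<dots> = (\<Sum>e\<in>?E. edge_energy f e)"
    using G vs(2) by (subst (1 2) v_eq) (simp add: laplacian_quadratic_form[OF vs(1)] finite_graph_def)
  also have "\<dots> \<le> (\<Sum>e\<in>?E. 2 * (\<Sum>u\<in>e. (f u)\<^sup>2))"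
    by (intro sum_mono edge_energy_le)
  also have "\<dots> = 2 * (\<Sum>u\<in>?V. real (card {e \<in> ?E. u \<in> e}) * (f u)\<^sup>2)"
    using G fin E by (subst sum_degree_weighted) (auto simp: finite_graph_def sum_distrib_left)
  also have "\<dots> \<le> 2 * (\<Sum>u\<in>?V. real d * (f u)\<^sup>2)"
    using deg by (intro mult_left_mono sum_mono mult_right_mono) auto
  also have "\<dots> = 2 * real d * (\<Sum>u\<in>?V. (f u)\<^sup>2)"
    by (simp add: sum_distrib_left mult.assoc)
  finally show ?thesis using pos by simp
qed

section \<open>Linear trees\<close>

text \<open>The neighbour towards the spine. Assigning to each pendant vertex the edge to its parent
  lets pendant vertices and pendant edges share one index set.\<close>

fun pendant_parent :: "nat \<Rightarrow> nat \<Rightarrow> nat \<Rightarrow> vertex" where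
  "pendant_parent j i 0 = Spine j"
| "pendant_parent j i (Suc p) = Pend j i p"

definition pendant_indices :: "nat list list \<Rightarrow> (nat \<times> nat \<times> nat) set" where
  "pendant_indices Ts = (SIGMA j:{..<length Ts}. SIGMA i:{..<length (Ts ! j)}. {..<Ts ! j ! i})"

lemma finite_pendant_indices [simp]: "finite (pendant_indices Ts)"
  by (simp add: pendant_indices_def)

lemma sum_pendant_indices:
  "(\<Sum>(j, i, p)\<in>pendant_indices Ts. g j i p)
    = (\<Sum>j<length Ts. \<Sum>i<length (Ts ! j). \<Sum>p<Ts ! j ! i. g j i p)"
  by (simp add: pendant_indices_def sum.Sigma split_def)

lemma pendant_parent_neq [simp]: "pendant_parent j i p \<noteq> Pend j i p" "Pend j i p \<noteq> pendant_parent j i p"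
  by (cases p; simp)+

text \<open>This injectivity allows sums over pendant edges to be reindexed by pendant
  vertices.\<close>

lemma pendant_edge_eq_iff:
  "{pendant_parent j i p, Pend j i p} = {pendant_parent j' i' p', Pend j' i' p'}
    \<longleftrightarrow> j = j' \<and> i = i' \<and> p = p'"
  by (cases p; cases p') (auto simp: doubleton_eq_iff)

lemma vertices_linear_tree:
  "fst (linear_tree Ts) = Spine ` {..<length Ts} \<union> (\<lambda>(j, i, p). Pend j i p) ` pendant_indices Ts"
proof -
  have "{Pend j i p |j i p. j < length Ts \<and> i < length (Ts ! j) \<and> p < Ts ! j ! i}
      = (\<lambda>(j, i, p). Pend j i p) ` pendant_indices Ts"
    by (force simp: pendant_indices_def image_iff)
  moreover have "{Spine j |j. j < length Ts} = Spine ` {..<length Ts}" by auto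
  ultimately show ?thesis by (simp add: linear_tree_def)
qed

lemma edges_linear_tree:
  "snd (linear_tree Ts) = (\<lambda>j. {Spine j, Spine (Suc j)}) ` {..<length Ts - 1}
    \<union> (\<lambda>(j, i, p). {pendant_parent j i p, Pend j i p}) ` pendant_indices Ts"
proof -
  let ?P = "\<lambda>j i p. j < length Ts \<and> i < length (Ts ! j) \<and> p < Ts ! j ! i"
  have "{{pendant_parent j i p, Pend j i p} |j i p. ?P j i p}
      = {{Spine j, Pend j i 0} |j i. ?P j i 0}
        \<union> {{Pend j i p, Pend j i (Suc p)} |j i p. ?P j i (Suc p)}" (is "?L = ?A \<union> ?B")
  proof (intro equalityI subsetI)
    fix e assume "e \<in> ?L"
    then obtain j i p where e: "e = {pendant_parent j i p, Pend j i p}" "?P j i p" by blast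
    show "e \<in> ?A \<union> ?B"
    proof (cases p)
      case 0
      then show ?thesis using e by auto
    next
      case (Suc p')
      then show ?thesis using e by auto
    qed
  next
    fix e assume "e \<in> ?A \<union> ?B"
    then show "e \<in> ?L"
    proof
      assume "e \<in> ?A"
      then obtain j i where "e = {pendant_parent j i 0, Pend j i 0}" "?P j i 0" by auto
      then show ?thesis by blast
    next
      assume "e \<in> ?B"
      then obtain j i p where "e = {pendant_parent j i (Suc p), Pend j i (Suc p)}" "?P j i (Suc p)"
        by auto
      then show ?thesis by blast
    qed
  qed
  moreover have "(\<lambda>(j, i, p). {pendant_parent j i p, Pend j i p}) ` pendant_indices Ts = ?L"
    by (force simp: pendant_indices_def image_iff)
  moreover have "(\<lambda>j. {Spine j, Spine (Suc j)}) ` {..<length Ts - 1}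
      = {{Spine j, Spine (Suc j)} |j. Suc j < length Ts}"
    by (auto simp: less_diff_conv)
  ultimately show ?thesis by (simp add: linear_tree_def Un_assoc)
qed

lemma sum_vertices_linear_tree:
  fixes g :: "vertex \<Rightarrow> real"
  shows "(\<Sum>u\<in>fst (linear_tree Ts). g u)
    = (\<Sum>j<length Ts. g (Spine j)) + (\<Sum>j<length Ts. \<Sum>i<length (Ts ! j). \<Sum>p<Ts ! j ! i. g (Pend j i p))"
proof -
  have "(\<Sum>u\<in>fst (linear_tree Ts). g u)
      = sum g (Spine ` {..<length Ts}) + sum g ((\<lambda>(j, i, p). Pend j i p) ` pendant_indices Ts)"
    unfolding vertices_linear_tree by (intro sum.union_disjoint) auto
  also have "sum g (Spine ` {..<length Ts}) = (\<Sum>j<length Ts. g (Spine j))"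
    by (subst sum.reindex) (auto simp: inj_on_def)
  also have "sum g ((\<lambda>(j, i, p). Pend j i p) ` pendant_indices Ts)
      = (\<Sum>(j, i, p)\<in>pendant_indices Ts. g (Pend j i p))"
    by (subst sum.reindex) (auto simp: inj_on_def split_def intro!: sum.cong)
  finally show ?thesis by (simp add: sum_pendant_indices)
qed

lemma energy_linear_tree:
  "(\<Sum>e\<in>snd (linear_tree Ts). edge_energy f e)
    = (\<Sum>j<length Ts - 1. (f (Spine j) - f (Spine (Suc j)))\<^sup>2)
      + (\<Sum>j<length Ts. \<Sum>i<length (Ts ! j). \<Sum>p<Ts ! j ! i. (f (pendant_parent j i p) - f (Pend j i p))\<^sup>2)"
proof -
  let ?s = "\<lambda>j. {Spine j, Spine (Suc j)}"
    and ?p = "\<lambda>(j, i, p). {pendant_parent j i p, Pend j i p}"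
  have "(\<Sum>e\<in>snd (linear_tree Ts). edge_energy f e)
      = sum (edge_energy f) (?s ` {..<length Ts - 1}) + sum (edge_energy f) (?p ` pendant_indices Ts)"
    unfolding edges_linear_tree by (intro sum.union_disjoint) (auto simp: doubleton_eq_iff)
  also have "sum (edge_energy f) (?s ` {..<length Ts - 1})
      = (\<Sum>j<length Ts - 1. (f (Spine j) - f (Spine (Suc j)))\<^sup>2)"
    by (subst sum.reindex) (auto simp: inj_on_def doubleton_eq_iff edge_energy_doubleton)
  also have "sum (edge_energy f) (?p ` pendant_indices Ts)
      = (\<Sum>(j, i, p)\<in>pendant_indices Ts. (f (pendant_parent j i p) - f (Pend j i p))\<^sup>2)"
    by (subst sum.reindex)
      (auto simp: inj_on_def pendant_edge_eq_iff edge_energy_doubleton intro!: sum.cong)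
  finally show ?thesis by (simp add: sum_pendant_indices)
qed

lemma finite_graph_linear_tree:
  assumes "Ts \<noteq> []"
  shows "finite_graph (linear_tree Ts)"
  unfolding finite_graph_def
proof (intro conjI ballI)
  show "finite (fst (linear_tree Ts))" "finite (snd (linear_tree Ts))"
    by (simp_all add: vertices_linear_tree edges_linear_tree)
  show "fst (linear_tree Ts) \<noteq> {}"
    using assms by (auto simp: vertices_linear_tree lessThan_empty_iff)
  fix e assume "e \<in> snd (linear_tree Ts)"
  then consider (s) j where "e = {Spine j, Spine (Suc j)}" "j < length Ts - 1"
    | (p) j i p where "e = {pendant_parent j i p, Pend j i p}" "(j, i, p) \<in> pendant_indices Ts"
    unfolding edges_linear_tree by auto
  then show "\<exists>a b. a \<in> fst (linear_tree Ts) \<and> b \<in> fst (linear_tree Ts) \<and> a \<noteq> b \<and> e = {a, b}"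
  proof cases
    case s
    then have "Spine j \<in> fst (linear_tree Ts)" "Spine (Suc j) \<in> fst (linear_tree Ts)"
      by (auto simp: vertices_linear_tree)
    then show ?thesis
      by (intro exI[of _ "Spine j"] exI[of _ "Spine (Suc j)"] conjI) (simp_all add: s(1))
  next
    case p
    have "Pend j i p \<in> fst (linear_tree Ts)"
      unfolding vertices_linear_tree using p(2) by (intro UnI2 image_eqI[of _ _ "(j, i, p)"]) auto
    moreover have "pendant_parent j i p \<in> fst (linear_tree Ts)"
    proof (cases p)
      case 0
      then show ?thesis using p(2) by (auto simp: vertices_linear_tree pendant_indices_def)
    next
      case (Suc p')
      then have "(j, i, p') \<in> pendant_indices Ts" using p(2) by (simp add: pendant_indices_def)
      then show ?thesis
        unfolding vertices_linear_tree Suc pendant_parent.simps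
        by (intro UnI2 image_eqI[of _ _ "(j, i, p')"]) auto
    qed
    ultimately show ?thesis
      by (intro exI[of _ "pendant_parent j i p"] exI[of _ "Pend j i p"] conjI) (simp_all add: p(1))
  qed
qed

text \<open>A spine vertex has at most two neighbours on the spine and \<open>w\<close> on pendant
  paths; a pendant vertex has at most two neighbours.\<close>

lemma degree_linear_tree_le:
  assumes "\<And>j. j < length Ts \<Longrightarrow> length (Ts ! j) \<le> w"
  shows "card {e \<in> snd (linear_tree Ts). u \<in> e} \<le> w + 2"
proof (cases u)
  case (Spine j)
  \<comment> \<open>For \<open>j = 0\<close> the difference \<open>j - 1\<close> is
    \<open>0\<close>, and the first extra set is a singleton instead of an edge, which is harmless
    in an upper bound.\<close>
  have "{e \<in> snd (linear_tree Ts). u \<in> e}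
      \<subseteq> (\<lambda>i. {Spine j, Pend j i 0}) ` {..<w} \<union> {{Spine (j - 1), Spine j}, {Spine j, Spine (Suc j)}}"
  proof
    fix e assume e: "e \<in> {e \<in> snd (linear_tree Ts). u \<in> e}"
    then consider (s) j' where "e = {Spine j', Spine (Suc j')}"
      | (p) j' i p where "e = {pendant_parent j' i p, Pend j' i p}" "(j', i, p) \<in> pendant_indices Ts"
      unfolding edges_linear_tree by auto
    then show "e \<in> (\<lambda>i. {Spine j, Pend j i 0}) ` {..<w} \<union> {{Spine (j - 1), Spine j}, {Spine j, Spine (Suc j)}}"
    proof cases
      case s
      then show ?thesis using e Spine by auto
    next
      case p
      then have "p = 0 \<and> j' = j" using e Spine by (cases p) auto
      moreover have "i < w" using p assms[of j'] by (auto simp: pendant_indices_def)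
      ultimately show ?thesis using p by auto
    qed
  qed
  then have "card {e \<in> snd (linear_tree Ts). u \<in> e}
      \<le> card ((\<lambda>i. {Spine j, Pend j i 0}) ` {..<w} \<union> {{Spine (j - 1), Spine j}, {Spine j, Spine (Suc j)}})"
    by (intro card_mono) auto
  also have "\<dots> \<le> card ((\<lambda>i. {Spine j, Pend j i 0}) ` {..<w})
      + card {{Spine (j - 1), Spine j}, {Spine j, Spine (Suc j)}}"
    by (rule card_Un_le)
  also have "\<dots> \<le> w + 2"
    using card_image_le[of "{..<w}" "\<lambda>i. {Spine j, Pend j i 0}"]
    by (intro add_mono) (auto simp: card_insert_if)
  finally show ?thesis .
next
  case (Pend j i p)
  have "{e \<in> snd (linear_tree Ts). u \<in> e}
      \<subseteq> {{pendant_parent j i p, Pend j i p}, {Pend j i p, Pend j i (Suc p)}}"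
  proof
    fix e assume e: "e \<in> {e \<in> snd (linear_tree Ts). u \<in> e}"
    then obtain j' i' p' where e': "e = {pendant_parent j' i' p', Pend j' i' p'}"
      unfolding edges_linear_tree using Pend by auto
    with e show "e \<in> {{pendant_parent j i p, Pend j i p}, {Pend j i p, Pend j i (Suc p)}}"
      using Pend by (cases p') auto
  qed
  then have "card {e \<in> snd (linear_tree Ts). u \<in> e}
      \<le> card {{pendant_parent j i p, Pend j i p}, {Pend j i p, Pend j i (Suc p)}}"
    by (intro card_mono) auto
  also have "\<dots> \<le> w + 2" by (simp add: card_insert_if)
  finally show ?thesis .
qed

section \<open>Pendant paths\<close>

text \<open>Along a pendant path the test vector solves the eigenvalue equation for \<open>\<nu>\<close> at every path
  vertex; \<open>c\<close> is its value at the spine. The weight is the squared norm of this solution for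
  \<open>c = 1\<close>, and at the same time the derivative of the drift.\<close>

fun pendant_value :: "real \<Rightarrow> real \<Rightarrow> nat \<Rightarrow> nat \<Rightarrow> real" where
  "pendant_value \<nu> c 0 p = 0"
| "pendant_value \<nu> c (Suc q) 0 = c / b_seq \<nu> (Suc q)"
| "pendant_value \<nu> c (Suc q) (Suc p) = pendant_value \<nu> (c / b_seq \<nu> (Suc q)) q p"

fun pendant_weight :: "real \<Rightarrow> nat \<Rightarrow> real" where
  "pendant_weight \<nu> 0 = 0"
| "pendant_weight \<nu> (Suc q) = (1 + pendant_weight \<nu> q) / (b_seq \<nu> (Suc q))\<^sup>2"

text \<open>The case \<open>q = 0\<close> must be set apart, because
  \<open>1 - 1 / b_seq \<nu> 0\<close> evaluates to \<open>1\<close>. With value \<open>0\<close> it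
  fits the tree \<open>[0]\<close>, and
  \<open>b_seq \<nu> (Suc q) = pendant_drift \<nu> q + 1 - \<nu>\<close> holds for every
  \<open>q\<close>.\<close>

definition pendant_drift :: "real \<Rightarrow> nat \<Rightarrow> real" where
  "pendant_drift \<nu> q = (if q = 0 then 0 else 1 - 1 / b_seq \<nu> q)"

text \<open>For \<open>\<nu> = 4\<close> the recursion has the fixed point \<open>- 1\<close>, and
  larger \<open>\<nu>\<close> only lowers the values.\<close>

lemma b_seq_le_minus_one:
  assumes "\<nu> \<ge> 4"
  shows "b_seq \<nu> (Suc q) \<le> - 1"
proof (induction q)
  case (Suc q)
  then have "- 1 \<le> 1 / b_seq \<nu> (Suc q)" by (simp add: le_divide_eq del: b_seq.simps)
  then show ?case using assms by simp
qed (use assms in simp)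

lemma b_seq_neq_0:
  "\<nu> \<ge> 4 \<Longrightarrow> b_seq \<nu> (Suc q) \<noteq> 0"
  using b_seq_le_minus_one[of \<nu> q] by linarith

lemma b_seq_Suc: 
  "b_seq \<nu> (Suc q) = (if q = 0 then 1 - \<nu> else 2 - \<nu> - 1 / b_seq \<nu> q)"
  by (cases q) auto

text \<open>Removing the path vertex next to the spine leaves a shorter path hanging from a vertex
  of value \<open>c / b_seq \<nu> (Suc q)\<close>.\<close>

lemma sum_pendant_value_squared:
  "(\<Sum>p<q. (pendant_value \<nu> c q p)\<^sup>2) = c\<^sup>2 * pendant_weight \<nu> q"
proof (induction q arbitrary: c)
  case (Suc q)
  have "(\<Sum>p<Suc q. (pendant_value \<nu> c (Suc q) p)\<^sup>2)
      = (c / b_seq \<nu> (Suc q))\<^sup>2 + (c / b_seq \<nu> (Suc q))\<^sup>2 * pendant_weight \<nu> q"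
    unfolding Suc.IH[symmetric]
    by (simp add: sum.lessThan_Suc_shift del: sum.lessThan_Suc b_seq.simps)
  also have "\<dots> = c\<^sup>2 * pendant_weight \<nu> (Suc q)"
    by (simp add: power_divide distrib_left add_divide_distrib del: b_seq.simps)
  finally show ?case .
qed simp

lemma pendant_weight_nonneg: "0 \<le> pendant_weight \<nu> q"
  by (induction q) auto

text \<open>As the eigenvalue equation holds on the path, energy minus \<open>\<nu>\<close> times
  the squared norm reduces to a boundary term at the spine. The induction again removes the path
  vertex next to the spine.\<close>

lemma pendant_energy:
  assumes "\<nu> \<ge> 4"
  shows "(\<Sum>p<q. ((case p of 0 \<Rightarrow> c | Suc p' \<Rightarrow> pendant_value \<nu> c q p') - pendant_value \<nu> c q p)\<^sup>2)
    = c\<^sup>2 * pendant_drift \<nu> q + \<nu> * (\<Sum>p<q. (pendant_value \<nu> c q p)\<^sup>2)"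
proof (induction q arbitrary: c)
  case 0
  show ?case by (simp add: pendant_drift_def)
next
  case (Suc q)
  let ?b = "b_seq \<nu> (Suc q)"
  let ?c = "c / ?b"
  have "(\<Sum>p<Suc q. ((case p of 0 \<Rightarrow> c | Suc p' \<Rightarrow> pendant_value \<nu> c (Suc q) p') - pendant_value \<nu> c (Suc q) p)\<^sup>2)
      = (c - ?c)\<^sup>2 + (\<Sum>p<q. (pendant_value \<nu> c (Suc q) p - pendant_value \<nu> ?c q p)\<^sup>2)"
    by (simp add: sum.lessThan_Suc_shift del: sum.lessThan_Suc b_seq.simps)
  also have "(\<Sum>p<q. (pendant_value \<nu> c (Suc q) p - pendant_value \<nu> ?c q p)\<^sup>2)
      = (\<Sum>p<q. ((case p of 0 \<Rightarrow> ?c | Suc p' \<Rightarrow> pendant_value \<nu> ?c q p') - pendant_value \<nu> ?c q p)\<^sup>2)"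
    by (intro sum.cong refl) (simp split: nat.split del: b_seq.simps)
  also have "\<dots> = ?c\<^sup>2 * pendant_drift \<nu> q + \<nu> * (\<Sum>p<q. (pendant_value \<nu> ?c q p)\<^sup>2)"
    by (rule Suc.IH)
  also have "(c - ?c)\<^sup>2 + (?c\<^sup>2 * pendant_drift \<nu> q + \<nu> * (\<Sum>p<q. (pendant_value \<nu> ?c q p)\<^sup>2))
      = c\<^sup>2 * pendant_drift \<nu> (Suc q) + \<nu> * (?c\<^sup>2 + (\<Sum>p<q. (pendant_value \<nu> ?c q p)\<^sup>2))"
  proof -
    have b: "?b \<noteq> 0" by (rule b_seq_neq_0[OF assms])
    have "pendant_drift \<nu> q = ?b - 1 + \<nu>"
      by (simp add: pendant_drift_def b_seq_Suc[of _ q] del: b_seq.simps)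
    moreover have "(c - ?c)\<^sup>2 + ?c\<^sup>2 * (?b - 1 + \<nu>) = c\<^sup>2 * (1 - 1 / ?b) + \<nu> * ?c\<^sup>2"
      using b by (simp add: field_simps power2_eq_square del: b_seq.simps)
    ultimately show ?thesis
      by (simp add: pendant_drift_def[of _ "Suc q"] distrib_left del: b_seq.simps)
  qed
  also have "?c\<^sup>2 + (\<Sum>p<q. (pendant_value \<nu> ?c q p)\<^sup>2) = (\<Sum>p<Suc q. (pendant_value \<nu> c (Suc q) p)\<^sup>2)"
    by (simp add: sum.lessThan_Suc_shift del: sum.lessThan_Suc b_seq.simps)
  finally show ?case .
qed

text \<open>Writing \<open>b_seq\<close> through the drift of the shorter path gives it the
  derivative \<open>1 + pendant_weight \<mu> q\<close>; the quotient rule then yields the recursion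
  of \<open>pendant_weight\<close>.\<close>

lemma has_field_derivative_pendant_drift:
  assumes "\<mu> \<ge> 4"
  shows "((\<lambda>\<epsilon>. pendant_drift (\<mu> - \<epsilon>) q) has_field_derivative pendant_weight \<mu> q) (at 0)"
proof (induction q)
  case 0
  show ?case by (simp add: pendant_drift_def)
next
  case (Suc q)
  have "b_seq (\<mu> - \<epsilon>) (Suc q) = pendant_drift (\<mu> - \<epsilon>) q + 1 - (\<mu> - \<epsilon>)" for \<epsilon>
    by (simp add: pendant_drift_def b_seq_Suc[of _ q] del: b_seq.simps)
  then have b: "((\<lambda>\<epsilon>. b_seq (\<mu> - \<epsilon>) (Suc q)) has_field_derivative 1 + pendant_weight \<mu> q) (at 0)"
    by (auto intro!: derivative_eq_intros Suc.IH simp del: b_seq.simps)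
  have "b_seq (\<mu> - 0) (Suc q) \<noteq> 0" using b_seq_neq_0[OF assms] by (simp del: b_seq.simps)
  from DERIV_diff[OF DERIV_const[of 1] DERIV_inverse'[OF b this]]
  show ?case
    by (simp add: pendant_drift_def power2_eq_square inverse_eq_divide del: b_seq.simps)
qed

lemma drift_eq_sum:
  assumes "starlike T"
  shows "drift T \<nu> = (\<Sum>i<length T. pendant_drift \<nu> (T ! i))"
proof (cases "T = [0]")
  case True
  then show ?thesis by (simp add: drift_def pendant_drift_def)
next
  case False
  then have "0 < T ! i" if "i < length T" for i
    using assms that by (auto simp: starlike_def)
  then show ?thesis
    using False
    by (auto simp: drift_def sum_list_sum_nth atLeast0LessThan pendant_drift_def intro!: sum.cong)
qed

lemma drift_deriv_eq_sum:
  assumes "starlike T" "\<mu> \<ge> 4"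
  shows "drift_deriv T \<mu> = (\<Sum>i<length T. pendant_weight \<mu> (T ! i))"
  unfolding drift_deriv_def drift_eq_sum[OF assms(1)]
  by (intro DERIV_imp_deriv DERIV_sum has_field_derivative_pendant_drift assms)

text \<open>All \<open>b_seq\<close> values at positive indices are negative, so every term
  \<open>1 - 1 / b_seq \<nu> q\<close> exceeds \<open>1\<close>.\<close>

lemma drift_nonneg:
  assumes "starlike T" "\<nu> \<ge> 4"
  shows "0 \<le> drift T \<nu>"
proof -
  have "0 \<le> pendant_drift \<nu> q" for q
    using b_seq_le_minus_one[OF assms(2), of "q - 1"]
    by (cases q) (auto simp: pendant_drift_def divide_le_eq simp del: b_seq.simps)
  then show ?thesis by (simp add: drift_eq_sum[OF assms(1)] sum_nonneg)
qed

section \<open>The test vector\<close>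

text \<open>Only the spine values \<open>s\<close> are free. Where \<open>s j = 0\<close>, the
  pendant paths at \<open>Spine j\<close> carry zeros as well.\<close>

fun test_vector :: "real \<Rightarrow> nat list list \<Rightarrow> (nat \<Rightarrow> real) \<Rightarrow> vertex \<Rightarrow> real" where
  "test_vector \<nu> Ts s (Spine j) = s j"
| "test_vector \<nu> Ts s (Pend j i p) = pendant_value \<nu> (s j) (Ts ! j ! i) p"

lemma norm_test_vector:
  assumes "\<nu> \<ge> 4" and star: "\<And>j. j < length Ts \<Longrightarrow> starlike (Ts ! j)"
  shows "(\<Sum>u\<in>fst (linear_tree Ts). (test_vector \<nu> Ts s u)\<^sup>2)
    = (\<Sum>j<length Ts. (s j)\<^sup>2 * (1 + drift_deriv (Ts ! j) \<nu>))"
proof -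
  have "(\<Sum>j<length Ts. (s j)\<^sup>2 * (1 + drift_deriv (Ts ! j) \<nu>))
      = (\<Sum>j<length Ts. (s j)\<^sup>2 + (\<Sum>i<length (Ts ! j). \<Sum>p<Ts ! j ! i. (pendant_value \<nu> (s j) (Ts ! j ! i) p)\<^sup>2))"
    using assms
    by (intro sum.cong refl)
      (simp add: drift_deriv_eq_sum sum_pendant_value_squared sum_distrib_left distrib_left)
  then show ?thesis by (simp add: sum_vertices_linear_tree sum.distrib)
qed

text \<open>The pendant paths are eliminated: apart from \<open>\<nu>\<close> times the squared
  norm, a quadratic form in the spine values remains, and the paths enter it only through the
  drift.\<close>

lemma energy_test_vector:
  assumes \<nu>: "\<nu> \<ge> 4" and star: "\<And>j. j < length Ts \<Longrightarrow> starlike (Ts ! j)"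
  shows "(\<Sum>e\<in>snd (linear_tree Ts). edge_energy (test_vector \<nu> Ts s) e)
    = (\<Sum>j<length Ts - 1. (s j - s (Suc j))\<^sup>2) + (\<Sum>j<length Ts. (s j)\<^sup>2 * (drift (Ts ! j) \<nu> - \<nu>))
      + \<nu> * (\<Sum>u\<in>fst (linear_tree Ts). (test_vector \<nu> Ts s u)\<^sup>2)"
proof -
  let ?v = "\<lambda>j i. pendant_value \<nu> (s j) (Ts ! j ! i)"
  have "(\<Sum>i<length (Ts ! j). \<Sum>p<Ts ! j ! i.
          (test_vector \<nu> Ts s (pendant_parent j i p) - test_vector \<nu> Ts s (Pend j i p))\<^sup>2)
      = (s j)\<^sup>2 * drift (Ts ! j) \<nu> + \<nu> * (\<Sum>i<length (Ts ! j). \<Sum>p<Ts ! j ! i. (?v j i p)\<^sup>2)"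
    if "j < length Ts" for j
  proof -
    have "test_vector \<nu> Ts s (pendant_parent j i p) = (case p of 0 \<Rightarrow> s j | Suc p' \<Rightarrow> ?v j i p')" for i p
      by (cases p) auto
    then show ?thesis
      using star[OF that]
      by (simp add: pendant_energy[OF \<nu>] drift_eq_sum sum.distrib sum_distrib_left)
  qed
  then have "(\<Sum>e\<in>snd (linear_tree Ts). edge_energy (test_vector \<nu> Ts s) e)
      = (\<Sum>j<length Ts - 1. (s j - s (Suc j))\<^sup>2)
        + (\<Sum>j<length Ts. (s j)\<^sup>2 * drift (Ts ! j) \<nu>
            + \<nu> * (\<Sum>i<length (Ts ! j). \<Sum>p<Ts ! j ! i. (?v j i p)\<^sup>2))"
    unfolding energy_linear_tree by simp
  then show ?thesis
    by (simp add: sum_vertices_linear_tree sum.distrib sum_distrib_left right_diff_distrib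
        sum_subtractf distrib_left mult.commute)
qed

section \<open>Elimination along the spine\<close>

lemma S_seq_Suc:
  "1 \<le> n \<Longrightarrow> S_seq T \<mu> (Suc n) = 2 - \<mu> - 1 / S_seq T \<mu> n + drift (T (Suc n)) \<mu>"
  by (cases n) auto

text \<open>The \<open>S_seq\<close> are the pivots of the Gaussian elimination that removes the spine vertices one
  after the other, starting from the first.\<close>

lemma spine_energy:
  assumes "1 \<le> n"
    and "\<And>m. 1 \<le> m \<Longrightarrow> m < n \<Longrightarrow> S_seq T \<mu> m \<noteq> 0 \<and> y (Suc m) = S_seq T \<mu> m * y m"
  shows "(\<Sum>m=1..n. (y m - y (Suc m))\<^sup>2 + (y m)\<^sup>2 * (drift (T m) \<mu> - \<mu>))
    = (y (Suc n))\<^sup>2 - 2 * y n * y (Suc n) + S_seq T \<mu> n * (y n)\<^sup>2"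
  using assms
proof (induction n rule: dec_induct)
  case base
  show ?case by (simp add: power2_eq_square algebra_simps)
next
  case (step n)
  define S where "S = S_seq T \<mu> n"
  have S: "S \<noteq> 0" "y (Suc n) = S * y n" using step by (auto simp: S_def)
  have "(\<Sum>m=1..Suc n. (y m - y (Suc m))\<^sup>2 + (y m)\<^sup>2 * (drift (T m) \<mu> - \<mu>))
      = (y (Suc n))\<^sup>2 - 2 * y n * y (Suc n) + S * (y n)\<^sup>2
        + ((y (Suc n) - y (Suc (Suc n)))\<^sup>2 + (y (Suc n))\<^sup>2 * (drift (T (Suc n)) \<mu> - \<mu>))"
    using step by (simp add: S_def)
  \<comment> \<open>Since \<open>y (Suc n) = S * y n\<close>, the terms
    \<open>- 2 * y n * y (Suc n) + S * (y n)\<^sup>2\<close> collapse to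
    \<open>- (y (Suc n))\<^sup>2 / S\<close>.\<close>
  also have "\<dots> = (y (Suc (Suc n)))\<^sup>2 - 2 * y (Suc n) * y (Suc (Suc n))
      + (2 - \<mu> - 1 / S + drift (T (Suc n)) \<mu>) * (y (Suc n))\<^sup>2"
    using S(1) unfolding S(2) by (simp add: field_simps power2_eq_square)
  finally show ?case using step by (simp add: S_seq_Suc S_def)
qed

section \<open>Uniform bound on the spectral radii\<close>

lemma shearer_graph_eq_linear_tree:
  assumes "1 \<le> k"
  shows "shearer_graph T C k
    = linear_tree (if k = 1 then [T 1] else map T [1..<k] @ [C k])"
  using assms by (simp add: shearer_graph_def)

text \<open>The successor accounts for \<open>[0]\<close>, which has length 1 but width 0.\<close>

lemma length_starlike_le: "length T \<le> Suc (width T)"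
  by (simp add: width_def)

lemma bounded_rho_L_shearer_graph:
  assumes "generalized_shearer_sequence T C"
  obtains B where "\<And>k. 1 \<le> k \<Longrightarrow> rho_L (shearer_graph T C k) \<le> B"
proof -
  obtain w1 w2 where w: "\<And>j. 1 \<le> j \<Longrightarrow> width (T j) \<le> w1" "\<And>j. 2 \<le> j \<Longrightarrow> width (C j) \<le> w2"
    using assms unfolding generalized_shearer_sequence_def by blast
  define w where "w = Suc (max w1 w2)"
  have len: "length (T j) \<le> w" if "1 \<le> j" for j
    using w(1)[OF that] length_starlike_le[of "T j"] by (simp add: w_def)
  have lenC: "length (C j) \<le> w" if "2 \<le> j" for j
    using w(2)[OF that] length_starlike_le[of "C j"] by (simp add: w_def)
  have "rho_L (shearer_graph T C k) \<le> 2 * real (w + 2)" if k: "1 \<le> k" for k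
  proof -
    define Ts where "Ts = (if k = 1 then [T 1] else map T [1..<k] @ [C k])"
    have "length (Ts ! j) \<le> w" if "j < length Ts" for j
    proof -
      have "Ts ! j \<in> set Ts" using that by simp
      then show ?thesis using k len lenC by (auto simp: Ts_def split: if_splits)
    qed
    then have "card {e \<in> snd (linear_tree Ts). u \<in> e} \<le> w + 2" for u
      by (rule degree_linear_tree_le)
    moreover have "finite_graph (linear_tree Ts)"
      by (rule finite_graph_linear_tree) (simp add: Ts_def)
    ultimately show ?thesis
      unfolding shearer_graph_eq_linear_tree[OF k] Ts_def[symmetric]
      by (intro rho_L_le_twice_max_degree) auto
  qed
  then show ?thesis using that by blast
qed

section \<open>Upper and lower bounds for the pivots\<close>

text \<open>The test vector has squared norm \<open>a\<close> and energy
  \<open>S_seq T \<mu> j + \<mu> * a\<close>, which \<open>energy_le_rho_L\<close> compares with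
  \<open>rho_L\<close> times \<open>a\<close>.\<close>

lemma S_seq_le:
  assumes \<mu>: "\<mu> \<ge> 4" and gss: "generalized_shearer_sequence T C" and j: "1 \<le> j"
    and nz: "\<And>n. 1 \<le> n \<Longrightarrow> n < j \<Longrightarrow> S_seq T \<mu> n \<noteq> 0"
  defines "a \<equiv> (\<Sum>m=1..j. (1 + drift_deriv (T m) \<mu>) / (\<Prod>n=m..<j. S_seq T \<mu> n)\<^sup>2)"
  shows "S_seq T \<mu> j \<le> (rho_L (shearer_graph T C (Suc j)) - \<mu>) * a"
proof -
  define Ts where "Ts = map T [1..<Suc j] @ [C (Suc j)]"
  \<comment> \<open>Solves \<open>y (Suc m) = S_seq T \<mu> m * y m\<close> below \<open>j\<close>,
    normalised to \<open>y j = 1\<close> by the empty product, and is cut off after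
    \<open>j\<close>.\<close>
  define y where "y m = (if m \<le> j then 1 / (\<Prod>n=m..<j. S_seq T \<mu> n) else 0)" for m
  \<comment> \<open>The shift reconciles spine vertices counted from 0 with \<open>T\<close> counted
    from 1.\<close>
  define f where "f = test_vector \<mu> Ts (\<lambda>m. y (Suc m))"
  have G: "shearer_graph T C (Suc j) = linear_tree Ts"
    using j by (simp add: shearer_graph_def Ts_def)
  have len: "length Ts = Suc j" by (simp add: Ts_def)
  have nth: "Ts ! m = (if m < j then T (Suc m) else C (Suc j))" if "m < length Ts" for m
    using that j by (auto simp: Ts_def nth_append simp del: upt_Suc)
  have star: "starlike (Ts ! m)" if "m < length Ts" for m
    using gss that j by (auto simp: generalized_shearer_sequence_def nth)
  have norm: "(\<Sum>u\<in>fst (linear_tree Ts). (f u)\<^sup>2) = a"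
  proof -
    have "(\<Sum>u\<in>fst (linear_tree Ts). (f u)\<^sup>2) = (\<Sum>m<j. (y (Suc m))\<^sup>2 * (1 + drift_deriv (T (Suc m)) \<mu>))"
    proof -
      have "(\<Sum>u\<in>fst (linear_tree Ts). (f u)\<^sup>2)
          = (\<Sum>m<length Ts. (y (Suc m))\<^sup>2 * (1 + drift_deriv (Ts ! m) \<mu>))"
        unfolding f_def by (rule norm_test_vector[OF \<mu> star])
      then show ?thesis by (simp add: len nth y_def)
    qed
    also have "\<dots> = a"
      unfolding a_def sum.atLeast1_atMost_eq[folded One_nat_def]
      by (intro sum.cong refl) (simp add: y_def power_divide)
    finally show ?thesis .
  qed
  have "(\<Sum>e\<in>snd (linear_tree Ts). edge_energy f e)
      = (\<Sum>m=1..j. (y m - y (Suc m))\<^sup>2 + (y m)\<^sup>2 * (drift (T m) \<mu> - \<mu>)) + \<mu> * a"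
  proof -
    have "(\<Sum>e\<in>snd (linear_tree Ts). edge_energy f e)
        = (\<Sum>m<length Ts - 1. (y (Suc m) - y (Suc (Suc m)))\<^sup>2)
          + (\<Sum>m<length Ts. (y (Suc m))\<^sup>2 * (drift (Ts ! m) \<mu> - \<mu>)) + \<mu> * a"
      unfolding norm[symmetric] unfolding f_def by (rule energy_test_vector[OF \<mu> star])
    \<comment> \<open>The last spine vertex has value \<open>y (Suc j) = 0\<close>, so it
      contributes only the edge term \<open>(y j - 0)\<^sup>2\<close>.\<close>
    then show ?thesis
      unfolding sum.atLeast1_atMost_eq[folded One_nat_def]
      by (simp add: len nth y_def[of "Suc (Suc j)"] y_def[of "Suc j"] sum.distrib)
  qed
  also have "(\<Sum>m=1..j. (y m - y (Suc m))\<^sup>2 + (y m)\<^sup>2 * (drift (T m) \<mu> - \<mu>)) = S_seq T \<mu> j"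
  proof -
    have "y (Suc m) = S_seq T \<mu> m * y m" if "1 \<le> m" "m < j" for m
      using that nz[OF that] by (simp add: y_def prod.atLeast_Suc_lessThan)
    \<comment> \<open>With \<open>y j = 1\<close> and \<open>y (Suc j) = 0\<close> only the pivot
      remains of the closed form.\<close>
    then show ?thesis using nz j by (subst spine_energy) (auto simp: y_def)
  qed
  finally have "(\<Sum>e\<in>snd (linear_tree Ts). edge_energy f e) = S_seq T \<mu> j + \<mu> * a" .
  moreover have "Ts \<noteq> []" by (simp add: Ts_def)
  ultimately have "S_seq T \<mu> j + \<mu> * a \<le> rho_L (linear_tree Ts) * a"
    using energy_le_rho_L[OF finite_graph_linear_tree, of Ts f] by (simp add: norm)
  then show ?thesis by (simp add: G algebra_simps)
qed

text \<open>After the first index, \<open>- 1 / S_seq T \<mu> n\<close> is positive and the drift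
  nonnegative, so even \<open>2 - \<mu>\<close> is a lower bound; \<open>1 - \<mu>\<close> also
  covers the first pivot.\<close>

lemma S_seq_ge:
  assumes "\<mu> \<ge> 4" "\<And>j. 1 \<le> j \<Longrightarrow> starlike (T j)" "1 \<le> j"
    and neg: "\<And>n. 1 \<le> n \<Longrightarrow> n < j \<Longrightarrow> S_seq T \<mu> n < 0"
  shows "1 - \<mu> \<le> S_seq T \<mu> j"
proof (cases "j = 1")
  case True
  then show ?thesis using drift_nonneg[of "T 1" \<mu>] assms by simp
next
  case False
  then obtain n where n: "j = Suc n" "1 \<le> n" using assms(3) by (cases j) auto
  have "1 / S_seq T \<mu> n \<le> 0" using neg[of n] n by (simp add: divide_le_0_iff)
  moreover have "0 \<le> drift (T (Suc n)) \<mu>" using assms by (simp add: drift_nonneg)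
  ultimately show ?thesis unfolding n(1) S_seq_Suc[OF n(2)] by linarith
qed

text \<open>A positive number and its inverse add up to at least 2. The value 4 is the threshold for
  the estimates on \<open>b_seq\<close>.\<close>

lemma mu_min_ge_4: "4 \<le> mu_min"
proof -
  \<comment> \<open>Hence \<open>19 - 3 * sqrt 33 > 1\<close>, and both cube roots are
    positive.\<close>
  have "sqrt 33 < 6" by (rule real_less_lsqrt) auto
  then have "0 < root 3 (19 + 3 * sqrt 33)" "0 < root 3 (19 - 3 * sqrt 33)"
    by (auto simp: add_pos_pos)
  then have "0 < root 3 (19 + 3 * sqrt 33) + root 3 (19 - 3 * sqrt 33) + 1" by linarith
  then have pos: "0 < omega" unfolding omega_def by simp
  have "0 \<le> (omega - 1)\<^sup>2 / omega" using pos by simp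
  also have "\<dots> = mu_min - 4"
    using pos by (simp add: mu_min_def field_simps power2_eq_square)
  finally show ?thesis by simp
qed

theorem theorem7p5:
  fixes \<mu> :: real and T C :: "nat \<Rightarrow> nat list"
  assumes "\<mu> \<ge> mu_min"
    and "generalized_shearer_sequence T C"
    and "dominated_by T C \<mu>"
    and "\<not> bounded ((\<lambda>j. \<Sum>m=1..j. (1 + drift_deriv (T m) \<mu>) / (\<Prod>n=m..<j. S_seq T \<mu> n)\<^sup>2) ` {1..})"
  shows "(\<lambda>k. rho_L (shearer_graph T C k)) \<longlonglongrightarrow> \<mu>"
proof -
  define r where "r k = rho_L (shearer_graph T C k)" for k
  define L where "L = lim r"
  define a where "a j = (\<Sum>m=1..j. (1 + drift_deriv (T m) \<mu>) / (\<Prod>n=m..<j. S_seq T \<mu> n)\<^sup>2)" for j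
  have \<mu>4: "\<mu> \<ge> 4" using assms(1) mu_min_ge_4 by linarith
  have star: "starlike (T j)" if "1 \<le> j" for j
    using assms(2) that by (simp add: generalized_shearer_sequence_def)
  obtain B where B: "\<And>k. 1 \<le> k \<Longrightarrow> r k \<le> B"
    using bounded_rho_L_shearer_graph[OF assms(2)] unfolding r_def by blast
  \<comment> \<open>The increase is assumed from index 1 on only, hence the shift.\<close>
  have inc: "incseq (\<lambda>k. r (Suc k))"
    using assms(2)
    by (intro incseq_SucI) (auto simp: generalized_shearer_sequence_def r_def intro: less_imp_le)
  obtain l where l: "(\<lambda>k. r (Suc k)) \<longlonglongrightarrow> l"
    by (rule incseq_convergent[OF inc, of B]) (use B in auto)
  then have "r \<longlonglongrightarrow> l" by (simp add: filterlim_sequentially_Suc[where f = r])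
  then have L: "r \<longlonglongrightarrow> L" by (simp add: L_def limI)
  then have L': "(\<lambda>k. r (Suc k)) \<longlonglongrightarrow> L" by (simp add: LIMSEQ_Suc)
  have r_le: "r (Suc j) \<le> L" for j by (rule incseq_le[OF inc L'])
  have "L \<le> \<mu>" using assms(3) by (simp add: dominated_by_def L_def r_def[abs_def])
  moreover have "\<not> L < \<mu>"
  proof
    assume less: "L < \<mu>"
    have dd: "0 \<le> drift_deriv (T m) \<mu>" if "1 \<le> m" for m
      using star[OF that] by (simp add: drift_deriv_eq_sum \<mu>4 sum_nonneg pendant_weight_nonneg)
    have a_ge: "1 \<le> a j" if j: "1 \<le> j" for j
    proof -
      have "1 \<le> 1 + drift_deriv (T j) \<mu>" using dd[OF j] by simp
      \<comment> \<open>The summand \<open>m = j\<close> has an empty product, and the other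
        summands are nonnegative.\<close>
      also have "\<dots> = (\<Sum>m\<in>{j}. (1 + drift_deriv (T m) \<mu>) / (\<Prod>n=m..<j. S_seq T \<mu> n)\<^sup>2)" by simp
      also have "\<dots> \<le> a j" unfolding a_def using j dd by (intro sum_mono2) auto
      finally show ?thesis .
    qed
    \<comment> \<open>Negativity of the earlier pivots is kept as a premise because the test vector
      divides by them; the strong induction for \<open>neg\<close> then discharges it.\<close>
    have S_le: "S_seq T \<mu> j \<le> - (\<mu> - L) * a j"
      if "1 \<le> j" "\<And>n. 1 \<le> n \<Longrightarrow> n < j \<Longrightarrow> S_seq T \<mu> n < 0" for j
    proof -
      have "S_seq T \<mu> n \<noteq> 0" if n: "1 \<le> n" "n < j" for n
        using \<open>\<And>n. 1 \<le> n \<Longrightarrow> n < j \<Longrightarrow> S_seq T \<mu> n < 0\<close>[OF n] by simp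
      then have "S_seq T \<mu> j \<le> (r (Suc j) - \<mu>) * a j"
        using S_seq_le[OF \<mu>4 assms(2) that(1)] by (simp add: a_def r_def)
      also have "\<dots> \<le> - (\<mu> - L) * a j"
        using r_le[of j] a_ge[OF that(1)] by (intro mult_right_mono) auto
      finally show ?thesis .
    qed
    have neg: "S_seq T \<mu> j < 0" if "1 \<le> j" for j
      using that
    proof (induction j rule: less_induct)
      case (less j)
      then have "S_seq T \<mu> j \<le> - (\<mu> - L) * a j" by (intro S_le) auto
      also have "\<dots> < 0" using \<open>L < \<mu>\<close> a_ge[OF less.prems] by (simp add: mult_less_0_iff)
      finally show ?case .
    qed
    have "norm (a j) \<le> (\<mu> - 1) / (\<mu> - L)" if j: "1 \<le> j" for j
    proof -
      have "1 - \<mu> \<le> - (\<mu> - L) * a j"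
        using S_seq_ge[OF \<mu>4 star j neg] S_le[OF j neg] by linarith
      then show ?thesis using less a_ge[OF j] by (simp add: field_simps)
    qed
    then have "bounded (a ` {1..})" by (auto simp: bounded_iff)
    then show False using assms(4) by (simp add: a_def[abs_def])
  qed
  ultimately show ?thesis using L by (simp add: r_def[abs_def])
qed

end
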